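(* Let $D\ge3$ and $n\ge2D$, let $\Gamma=(X,\mathcal{R})$ be the Johnson graph $J(n,D)$, and fix $x\in X$. Then $\Gamma$ does not support a uniform structure with respect to $x$.
   Context: Johnson graph $J(n,D)$: vertices are the $D$-subsets of an $n$-set, adjacent iff their intersection has size $D-1$. For a graph with distance $\partial$ and fixed $x$ of eccentricity $\varepsilon$: $V=\mathbb{C}^X$, $A$ the adjacency matrix, $E_i^*$ the diagonal $0/1$ matrix with $(y,y)$-entry $1$ iff $\partial(x,y)=i$; $L=\sum_{i=1}^{\varepsilon}E^*_{i-1}AE^*_i$, $R=\sum_{i=0}^{\varepsilon-1}E^*_{i+1}AE^*_i=L^\top$. $\Gamma_f$ is the graph on $X$ whose edges are the edges $yz$ of $\Gamma$ with $\partial(x,y)\ne\partial(x,z)$ (bipartite with lowering/raising matrices $L,R$). A parameter matrix is a tridiagonal complex $U=(e_{ij})_{1\le i,j\le\varepsilon}$ with $e_{ii}=1$, with $e_{i,i-1}\ne0$ for all $2\le i\le\varepsilon$ or $e_{i-1,i}\ne0$ for all $2\le i\le\varepsilon$, and every principal submatrix $(e_{ij})_{s\le i,j\le t}$ nonsingular; $e_i^-=e_{i,i-1}$, $e_i^+=e_{i,i+1}$, $e_1^-=e_\varepsilon^+=0$. A bipartite graph admits a uniform structure w.r.t. $x$ if there exist such $U$ and $f\in\mathbb{C}^\varepsilon$ with $e_i^-RL^2+LRL+e_i^+L^2R=f_iL$ on $E_i^*V$ for all $1\le i\le\varepsilon$; a non-bipartite $\Gamma$ supports a uniform structure w.r.t.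 $x$ if $\Gamma_f$ admits one. *)

theory Defs
  imports "Jordan_Normal_Form.Determinant" "HOL-Analysis.Analysis"
begin

text \<open>
  A finite simple graph is given by a vertex set \<open>X\<close> inside a finite type \<open>'v\<close> and a symmetric,
  irreflexive relation \<open>E \<subseteq> X \<times> X\<close>.  Matrices with rows and columns indexed by \<open>X\<close> are represented
  as matrices over all of \<open>'v\<close> whose entries outside \<open>X \<times> X\<close> are zero; this is compatible with sums,
  products and transposes.
\<close>

text \<open>The relational power \<open>E ^^ k\<close> consists of the pairs joined by a walk of length \<open>k\<close>.  The value
  is only meaningful for vertices in the same connected component.\<close>

definition graph_dist :: "('v \<times> 'v) set \<Rightarrow> 'v \<Rightarrow> 'v \<Rightarrow> nat" where
  "graph_dist E y z = (LEAST k. (y, z) \<in> E ^^ k)"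

definition eccentricity :: "'v set \<Rightarrow> ('v \<times> 'v) set \<Rightarrow> 'v \<Rightarrow> nat" where
  "eccentricity X E x = Max (graph_dist E x ` X)"

definition adjacency :: "('v \<times> 'v) set \<Rightarrow> complex ^ 'v ^ 'v" where
  "adjacency E = (\<chi> y z. if (y, z) \<in> E then 1 else 0)"

definition dual_idem :: "'v set \<Rightarrow> ('v \<times> 'v) set \<Rightarrow> 'v \<Rightarrow> nat \<Rightarrow> complex ^ 'v ^ 'v" where
  "dual_idem X E x i = (\<chi> y z. if y = z \<and> y \<in> X \<and> graph_dist E x y = i then 1 else 0)"

definition lowering :: "'v::finite set \<Rightarrow> ('v \<times> 'v) set \<Rightarrow> 'v \<Rightarrow> complex ^ 'v ^ 'v" where
  "lowering X E x = (\<Sum>i = 1..eccentricity X E x.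
     dual_idem X E x (i - 1) ** adjacency E ** dual_idem X E x i)"

definition raising :: "'v::finite set \<Rightarrow> ('v \<times> 'v) set \<Rightarrow> 'v \<Rightarrow> complex ^ 'v ^ 'v" where
  "raising X E x = (\<Sum>i < eccentricity X E x.
     dual_idem X E x (i + 1) ** adjacency E ** dual_idem X E x i)"

text \<open>A parameter matrix of order \<open>\<epsilon>\<close> is a function \<open>U\<close> whose values \<open>U i j\<close> with
  \<open>1 \<le> i, j \<le> \<epsilon>\<close> are the entries; other values are irrelevant.\<close>

definition principal_submatrix :: "(nat \<Rightarrow> nat \<Rightarrow> complex) \<Rightarrow> nat \<Rightarrow> nat \<Rightarrow> complex Matrix.mat" where
  "principal_submatrix U s t = Matrix.mat (t + 1 - s) (t + 1 - s) (\<lambda>(i, j). U (s + i) (s + j))"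

definition parameter_matrix :: "nat \<Rightarrow> (nat \<Rightarrow> nat \<Rightarrow> complex) \<Rightarrow> bool" where
  "parameter_matrix \<epsilon> U \<longleftrightarrow>
     (\<forall>i\<in>{1..\<epsilon>}. \<forall>j\<in>{1..\<epsilon>}. i + 1 < j \<or> j + 1 < i \<longrightarrow> U i j = 0) \<and>
     (\<forall>i\<in>{1..\<epsilon>}. U i i = 1) \<and>
     ((\<forall>i\<in>{2..\<epsilon>}. U i (i - 1) \<noteq> 0) \<or> (\<forall>i\<in>{2..\<epsilon>}. U (i - 1) i \<noteq> 0)) \<and>
     (\<forall>s t. 1 \<le> s \<and> s \<le> t \<and> t \<le> \<epsilon> \<longrightarrow> Determinant.det (principal_submatrix U s t) \<noteq> 0)"

definition e_minus :: "(nat \<Rightarrow> nat \<Rightarrow> complex) \<Rightarrow> nat \<Rightarrow> complex" where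
  "e_minus U i = (if i = 1 then 0 else U i (i - 1))"

definition e_plus :: "nat \<Rightarrow> (nat \<Rightarrow> nat \<Rightarrow> complex) \<Rightarrow> nat \<Rightarrow> complex" where
  "e_plus \<epsilon> U i = (if i = \<epsilon> then 0 else U i (i + 1))"

text \<open>This is meant for connected bipartite graphs \<open>(X, E)\<close>.  The set \<open>range ((*v) (dual_idem X E x i))\<close>
  is the space of vectors supported on the vertices at distance \<open>i\<close> from \<open>x\<close>.\<close>

definition admits_uniform_structure :: "'v::finite set \<Rightarrow> ('v \<times> 'v) set \<Rightarrow> 'v \<Rightarrow> bool" where
  "admits_uniform_structure X E x \<longleftrightarrow>
     (let \<epsilon> = eccentricity X E x; L = lowering X E x; R = raising X E x in
      \<exists>(U :: nat \<Rightarrow> nat \<Rightarrow> complex) (f :: nat \<Rightarrow> complex).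
        parameter_matrix \<epsilon> U \<and>
        (\<forall>i\<in>{1..\<epsilon>}. \<forall>v \<in> range ((*v) (dual_idem X E x i)).
           e_minus U i *s ((R ** L ** L) *v v) + (L ** R ** L) *v v
             + e_plus \<epsilon> U i *s ((L ** L ** R) *v v)
           = f i *s (L *v v)))"

definition flat_edges :: "('v \<times> 'v) set \<Rightarrow> 'v \<Rightarrow> ('v \<times> 'v) set" where
  "flat_edges E x = {(y, z) \<in> E. graph_dist E x y \<noteq> graph_dist E x z}"

text \<open>The notion is meant for non-bipartite connected graphs.  For a bipartite connected graph
  \<open>flat_edges E x = E\<close>, so no separate clause is needed there.\<close>

definition supports_uniform_structure :: "'v::finite set \<Rightarrow> ('v \<times> 'v) set \<Rightarrow> 'v \<Rightarrow> bool" where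
  "supports_uniform_structure X E x \<longleftrightarrow> admits_uniform_structure X (flat_edges E x) x"

text \<open>The Johnson graph \<open>J(n, D)\<close> on the \<open>n\<close>-set \<open>UNIV :: 'a set\<close>, where \<open>n = CARD('a)\<close>.\<close>

definition johnson_vertices :: "nat \<Rightarrow> 'a::finite set set" where
  "johnson_vertices D = {y. card y = D}"

text \<open>For \<open>D \<ge> 1\<close> this says that the intersection has size \<open>D - 1\<close>, without truncated
  subtraction.\<close>

definition johnson_edges :: "nat \<Rightarrow> ('a::finite set \<times> 'a set) set" where
  "johnson_edges D = {(y, z). y \<in> johnson_vertices D \<and> z \<in> johnson_vertices D \<and>
     card (y \<inter> z) + 1 = D}"

end

theory Submission
  imports Defs
begin

text \<open>
  Encode a \<open>D\<close>-set \<open>y\<close> as the pair \<open>(S, T) = (x - y, y - x)\<close> of sets of equal size \<open>i\<close>.  Lowering in the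
  flattened graph deletes one point from each, so \<open>L\<close> is the tensor product of the lowering maps of the
  Boolean lattices on \<open>x\<close> and on \<open>- x\<close>, and every matrix entry of \<open>RL\<^sup>2\<close>, \<open>LRL\<close> and \<open>L\<^sup>2R\<close> is a
  product of two path counts.  For \<open>2 \<le> i < D\<close> the entries with \<open>S' = S - a - a' + c\<close> or \<open>S' = S - a\<close>,
  and likewise for \<open>T'\<close>, at least one of the two being an exchange, do not involve \<open>f\<^sub>i\<close> and give
  \<open>e\<^sup>- + 1 + e\<^sup>+ = 0\<close> and \<open>2(i - 1)e\<^sup>- + N + 2(N - i)e\<^sup>+ = 0\<close> for both \<open>N = D\<close> and \<open>N = n - D\<close>.
  If \<open>n \<noteq> 2D\<close> this is inconsistent at \<open>i = 2\<close>.  If \<open>n = 2D\<close> it is inconsistent at \<open>i = (D + 1)/2\<close> for odd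
  \<open>D\<close>; for even \<open>D\<close> it forces \<open>e\<^sup>-\<close> to vanish at \<open>D/2\<close> and \<open>e\<^sup>+\<close> to vanish at \<open>D/2 + 1\<close>, which a
  parameter matrix does not allow.
\<close>

section \<open>Path counts in a Boolean lattice\<close>

text \<open>Complex-valued because it serves as the \<open>(A, B)\<close> entry of the lowering
  matrix of a Boolean lattice.\<close>

definition covers :: "'a set \<Rightarrow> 'a set \<Rightarrow> complex" where
  "covers A B = of_bool (A \<subseteq> B \<and> card B = Suc (card A))"

text \<open>This and the next two are the \<open>(S', S)\<close> entries of
  \<open>RL\<^sup>2\<close>, \<open>LRL\<close> and \<open>L\<^sup>2R\<close> for the Boolean
  lattice on \<open>N\<close>; as in a matrix product, a path starting at \<open>S\<close> is read
  from right to left.\<close>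

definition paths_rll :: "'a set \<Rightarrow> 'a set \<Rightarrow> 'a set \<Rightarrow> complex" where
  "paths_rll N S' S = (\<Sum>A\<in>Pow N. \<Sum>B\<in>Pow N. covers A S' * covers A B * covers B S)"

definition paths_lrl :: "'a set \<Rightarrow> 'a set \<Rightarrow> 'a set \<Rightarrow> complex" where
  "paths_lrl N S' S = (\<Sum>A\<in>Pow N. \<Sum>B\<in>Pow N. covers S' A * covers B A * covers B S)"

definition paths_llr :: "'a set \<Rightarrow> 'a set \<Rightarrow> 'a set \<Rightarrow> complex" where
  "paths_llr N S' S = (\<Sum>A\<in>Pow N. \<Sum>B\<in>Pow N. covers S' A * covers A B * covers S B)"

lemma sum_of_bool_complex:
  "finite A \<Longrightarrow> (\<Sum>x\<in>A. of_bool (P x) :: complex) = of_nat (card {x\<in>A. P x})"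
  by (simp add: of_bool_def sum.If_cases Int_def)

lemma sum_lower_covers:
  assumes "finite N" "S \<subseteq> N"
  shows "(\<Sum>A\<in>Pow N. covers A S * g A) = (\<Sum>b\<in>S. g (S - {b}))"
proof -
  have fS: "finite S" using assms finite_subset by blast
  have eq: "{A \<in> Pow N. A \<subseteq> S \<and> card S = Suc (card A)} = (\<lambda>b. S - {b}) ` S" (is "?l = ?r")
  proof
    show "?l \<subseteq> ?r"
    proof
      fix A assume "A \<in> ?l"
      then have A: "A \<subseteq> S" "card S = Suc (card A)" by auto
      have "card (S - A) = 1" using A fS by (simp add: card_Diff_subset finite_subset)
      then obtain b where "S - A = {b}" using card_1_singletonE by blast
      then have "A = S - {b}" "b \<in> S" using A by auto
      then show "A \<in> ?r" by blast
    qed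
    have "card S > 0" if "b \<in> S" for b using that fS card_gt_0_iff by blast
    then show "?r \<subseteq> ?l" using assms fS by auto
  qed
  have "(\<Sum>A\<in>Pow N. covers A S * g A)
      = (\<Sum>A\<in>{A \<in> Pow N. A \<subseteq> S \<and> card S = Suc (card A)}. g A)"
    using assms by (intro sum.mono_neutral_cong_right) (auto simp: covers_def)
  also have "\<dots> = (\<Sum>b\<in>S. g (S - {b}))"
    unfolding eq by (subst sum.reindex) (auto simp: inj_on_def)
  finally show ?thesis .
qed

lemma sum_upper_covers:
  assumes "finite N" "S \<subseteq> N"
  shows "(\<Sum>A\<in>Pow N. covers S A * g A) = (\<Sum>b\<in>N - S. g (insert b S))"
proof -
  have fS: "finite S" using assms finite_subset by blast
  have eq: "{A \<in> Pow N. S \<subseteq> A \<and> card A = Suc (card S)} = (\<lambda>b. insert b S) ` (N - S)" (is "?l = ?r")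
  proof
    show "?l \<subseteq> ?r"
    proof
      fix A assume "A \<in> ?l"
      then have A: "S \<subseteq> A" "card A = Suc (card S)" "A \<subseteq> N" by auto
      have "card (A - S) = 1" using A fS by (simp add: card_Diff_subset)
      then obtain b where "A - S = {b}" using card_1_singletonE by blast
      then have "A = insert b S" "b \<in> N - S" using A by auto
      then show "A \<in> ?r" by blast
    qed
    show "?r \<subseteq> ?l"
      using assms fS by auto
  qed
  have "(\<Sum>A\<in>Pow N. covers S A * g A)
      = (\<Sum>A\<in>{A \<in> Pow N. S \<subseteq> A \<and> card A = Suc (card S)}. g A)"
    using assms by (intro sum.mono_neutral_cong_right) (auto simp: covers_def)
  also have "\<dots> = (\<Sum>b\<in>N - S. g (insert b S))"
    unfolding eq by (subst sum.reindex) (auto simp: inj_on_def)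
  finally show ?thesis .
qed

text \<open>An interval of length two in a Boolean lattice has exactly two elements strictly between
  its ends.\<close>

lemma sum_intermediate_covers:
  assumes "finite N" "A \<subseteq> N" "S \<subseteq> N" "card S = Suc (Suc (card A))"
  shows "(\<Sum>B\<in>Pow N. covers A B * covers B S) = 2 * of_bool (A \<subseteq> S)"
proof -
  have fin: "finite A" "finite S" using assms finite_subset by blast+
  have "(\<Sum>B\<in>Pow N. covers A B * covers B S) = (\<Sum>b\<in>N - A. covers (insert b A) S)"
    by (rule sum_upper_covers[OF assms(1,2)])
  also have "\<dots> = (\<Sum>b\<in>N - A. of_bool (b \<in> S \<and> A \<subseteq> S))"
    by (rule sum.cong) (use fin assms in \<open>auto simp: covers_def\<close>)
  also have "\<dots> = of_nat (card {b\<in>N - A. b \<in> S \<and> A \<subseteq> S})"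
    using assms by (intro sum_of_bool_complex) auto
  also have "\<dots> = 2 * of_bool (A \<subseteq> S)"
  proof (cases "A \<subseteq> S")
    case True
    then have "{b\<in>N - A. b \<in> S \<and> A \<subseteq> S} = S - A" using assms by auto
    moreover have "card (S - A) = 2" using True fin assms by (simp add: card_Diff_subset)
    ultimately show ?thesis using True by simp
  qed simp
  finally show ?thesis .
qed

text \<open>Once \<open>b\<close> has been deleted from \<open>S'\<close>, two chains climb to
  \<open>S\<close>, provided that what remains lies in \<open>S\<close>.\<close>

lemma paths_rll_eq:
  assumes "finite N" "S' \<subseteq> N" "S \<subseteq> N" "card S = Suc (card S')"
  shows "paths_rll N S' S = 2 * of_nat (card {b\<in>S'. S' - {b} \<subseteq> S})"
proof -
  have fin: "finite S'" using assms finite_subset by blast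
  have "paths_rll N S' S = (\<Sum>A\<in>Pow N. covers A S' * (\<Sum>B\<in>Pow N. covers A B * covers B S))"
    by (simp add: paths_rll_def sum_distrib_left mult.assoc)
  also have "\<dots> = (\<Sum>b\<in>S'. \<Sum>B\<in>Pow N. covers (S' - {b}) B * covers B S)"
    by (rule sum_lower_covers[OF assms(1,2)])
  also have "\<dots> = (\<Sum>b\<in>S'. 2 * of_bool (S' - {b} \<subseteq> S))"
  proof (intro sum.cong refl sum_intermediate_covers)
    fix b assume "b \<in> S'"
    then show "card S = Suc (Suc (card (S' - {b})))" using assms fin by (metis card_Suc_Diff1)
  qed (use assms in auto)
  also have "\<dots> = 2 * of_nat (card {b\<in>S'. S' - {b} \<subseteq> S})"
    using fin by (simp only: sum_distrib_left[symmetric] sum_of_bool_complex)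
  finally show ?thesis .
qed

text \<open>The lower set \<open>B\<close> is any subset of \<open>insert b S' \<inter> S\<close> of
  size \<open>card S'\<close>. The binomial is zero when this intersection is too small.\<close>

lemma paths_lrl_eq:
  assumes "finite N" "S' \<subseteq> N" "S \<subseteq> N" "card S = Suc (card S')"
  shows "paths_lrl N S' S = (\<Sum>b\<in>N - S'. of_nat (card (insert b S' \<inter> S) choose card S'))"
proof -
  have fin: "finite S'" "finite S" using assms finite_subset by blast+
  have "paths_lrl N S' S = (\<Sum>A\<in>Pow N. covers S' A * (\<Sum>B\<in>Pow N. covers B A * covers B S))"
    by (simp add: paths_lrl_def sum_distrib_left mult.assoc)
  also have "\<dots> = (\<Sum>b\<in>N - S'. \<Sum>B\<in>Pow N. covers B (insert b S') * covers B S)"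
    by (rule sum_upper_covers[OF assms(1,2)])
  also have "\<dots> = (\<Sum>b\<in>N - S'. of_nat (card (insert b S' \<inter> S) choose card S'))"
  proof (rule sum.cong[OF refl])
    fix b assume b: "b \<in> N - S'"
    have "(\<Sum>B\<in>Pow N. covers B (insert b S') * covers B S)
       = (\<Sum>B\<in>Pow N. of_bool (B \<subseteq> insert b S' \<inter> S \<and> card B = card S'))"
      by (rule sum.cong) (use b fin assms in \<open>auto simp: covers_def\<close>)
    also have "\<dots> = of_nat (card {B\<in>Pow N. B \<subseteq> insert b S' \<inter> S \<and> card B = card S'})"
      using assms by (intro sum_of_bool_complex) auto
    also have "{B\<in>Pow N. B \<subseteq> insert b S' \<inter> S \<and> card B = card S'}
        = {B. B \<subseteq> insert b S' \<inter> S \<and> card B = card S'}"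
      using assms by auto
    also have "card \<dots> = card (insert b S' \<inter> S) choose card S'"
      using fin by (intro n_subsets) auto
    finally show "(\<Sum>B\<in>Pow N. covers B (insert b S') * covers B S)
      = of_nat (card (insert b S' \<inter> S) choose card S')" .
  qed
  finally show ?thesis .
qed

lemma paths_llr_eq:
  assumes "finite N" "S' \<subseteq> N" "S \<subseteq> N" "card S = Suc (card S')"
  shows "paths_llr N S' S = 2 * of_nat (card {b\<in>N - S. S' \<subseteq> insert b S})"
proof -
  have fin: "finite S'" "finite S" using assms finite_subset by blast+
  \<comment> \<open>With the sums interchanged, the outer variable is the upper set, which is
    \<open>S\<close> with one point added.\<close>
  have "paths_llr N S' S = (\<Sum>B\<in>Pow N. \<Sum>A\<in>Pow N. covers S' A * covers A B * covers S B)"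
    unfolding paths_llr_def by (rule sum.swap)
  also have "\<dots> = (\<Sum>B\<in>Pow N. covers S B * (\<Sum>A\<in>Pow N. covers S' A * covers A B))"
    by (simp add: sum_distrib_left mult_ac)
  also have "\<dots> = (\<Sum>b\<in>N - S. \<Sum>A\<in>Pow N. covers S' A * covers A (insert b S))"
    by (rule sum_upper_covers[OF assms(1,3)])
  also have "\<dots> = (\<Sum>b\<in>N - S. 2 * of_bool (S' \<subseteq> insert b S))"
    by (intro sum.cong refl sum_intermediate_covers) (use assms fin in auto)
  also have "\<dots> = 2 * of_nat (card {b\<in>N - S. S' \<subseteq> insert b S})"
    using assms(1) by (simp only: sum_distrib_left[symmetric] sum_of_bool_complex finite_Diff)
  finally show ?thesis .
qed

text \<open>For \<open>paths_lrl\<close>, adding \<open>a\<close> back gives all of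
  \<open>S\<close>, from which any of its points may be dropped. Any of the
  \<open>card N - card S\<close> points outside \<open>S\<close> has to be dropped again at once.
  Together this makes \<open>card N\<close>.\<close>

lemma paths_remove:
  assumes "finite N" "S \<subseteq> N" "a \<in> S"
  shows "paths_rll N (S - {a}) S = 2 * (of_nat (card S) - 1)"
    and "paths_lrl N (S - {a}) S = of_nat (card N)"
    and "paths_llr N (S - {a}) S = 2 * (of_nat (card N) - of_nat (card S))"
proof -
  have fin: "finite S" using assms finite_subset by blast
  have cS: "card S = Suc (card (S - {a}))" using fin assms by (metis card_Suc_Diff1)
  have le: "card S \<le> card N" using assms by (simp add: card_mono)
  have sub: "S - {a} \<subseteq> N" using assms by auto
  have "{b \<in> S - {a}. S - {a} - {b} \<subseteq> S} = S - {a}" by auto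
  then show "paths_rll N (S - {a}) S = 2 * (of_nat (card S) - 1)"
    using cS by (simp add: paths_rll_eq[OF assms(1) sub assms(2) cS] del: card_Diff_singleton)
  have "{b \<in> N - S. S - {a} \<subseteq> insert b S} = N - S" by auto
  then show "paths_llr N (S - {a}) S = 2 * (of_nat (card N) - of_nat (card S))"
    using assms fin le by (simp add: paths_llr_eq[OF assms(1) sub assms(2) cS] card_Diff_subset)
  have split: "N - (S - {a}) = insert a (N - S)" using assms by auto
  have "(\<Sum>b\<in>N - S. of_nat (card (insert b (S - {a}) \<inter> S) choose card (S - {a})) :: complex)
      = (\<Sum>b\<in>N - S. 1)"
  proof (rule sum.cong[OF refl])
    fix b assume "b \<in> N - S"
    then have "insert b (S - {a}) \<inter> S = S - {a}" by auto
    then show "(of_nat (card (insert b (S - {a}) \<inter> S) choose card (S - {a})) :: complex) = 1"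
      by (simp del: card_Diff_singleton)
  qed
  also have "\<dots> = of_nat (card N) - of_nat (card S)"
    using assms fin le by (simp add: card_Diff_subset)
  finally have rest: "(\<Sum>b\<in>N - S. of_nat (card (insert b (S - {a}) \<inter> S) choose card (S - {a})) :: complex)
     = of_nat (card N) - of_nat (card S)" .
  have "insert a (S - {a}) \<inter> S = S" using assms by auto
  then have first: "(of_nat (card (insert a (S - {a}) \<inter> S) choose card (S - {a})) :: complex) = of_nat (card S)"
    using cS by (metis binomial_Suc_n)
  have "a \<notin> N - S" "finite (N - S)" using assms by auto
  then show "paths_lrl N (S - {a}) S = of_nat (card N)"
    unfolding paths_lrl_eq[OF assms(1) sub assms(2) cS] split
    by (subst sum.insert) (simp_all only: rest first, simp_all)
qed

text \<open>The point deleted first from \<open>S'\<close> in \<open>paths_rll\<close>, or added to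
  \<open>S\<close> in \<open>paths_llr\<close>, must be \<open>c\<close>, and two chains remain. In
  \<open>paths_lrl\<close> the point added is \<open>a\<close> or \<open>a'\<close>, and then
  \<open>c\<close> must go.\<close>

lemma paths_exchange:
  assumes "finite N" "S \<subseteq> N" "a \<in> S" "a' \<in> S" "a \<noteq> a'" "c \<in> N - S"
  defines "S' \<equiv> insert c (S - {a, a'})"
  shows "card S = Suc (card S')"
    and "paths_rll N S' S = 2" "paths_lrl N S' S = 2" "paths_llr N S' S = 2"
proof -
  have fin: "finite S" using assms finite_subset by blast
  have fin': "finite S'" using fin by (simp add: S'_def)
  have c2: "card S = Suc (Suc (card (S - {a, a'})))"
    using fin assms(3-5) card_Diff_subset[of "{a,a'}" S] card_mono[of S "{a,a'}"] by simp
  show cS: "card S = Suc (card S')" using c2 fin assms(6) by (simp add: S'_def)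
  have sub: "S' \<subseteq> N" using assms by auto
  note hyps = assms(1) sub assms(2) cS
  have "{b \<in> S'. S' - {b} \<subseteq> S} = {c}" using assms(6) by (auto simp: S'_def)
  then show "paths_rll N S' S = 2" by (simp add: paths_rll_eq[OF hyps])
  have "{b \<in> N - S. S' \<subseteq> insert b S} = {c}" using assms(6) by (auto simp: S'_def)
  then show "paths_llr N S' S = 2" by (simp add: paths_llr_eq[OF hyps])
  have split: "N - S' = insert a (insert a' (N - S - {c}))" using assms by (auto simp: S'_def)
  have nin: "a \<notin> insert a' (N - S - {c})" "a' \<notin> N - S - {c}" "finite (N - S - {c})"
    using assms by auto
  have "insert a S' \<inter> S = insert a (S - {a, a'})" "insert a' S' \<inter> S = insert a' (S - {a, a'})"
    using assms by (auto simp: S'_def)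
  then have a: "card (insert a S' \<inter> S) = card S'" "card (insert a' S' \<inter> S) = card S'"
    using c2 cS fin by simp_all
  \<comment> \<open>A point outside \<open>S\<close> leaves only \<open>S - {a, a'}\<close> in
    common with \<open>S\<close>, which is one point too few.\<close>
  have b: "card (insert b S' \<inter> S) choose card S' = 0" if "b \<in> N - S - {c}" for b
  proof -
    have "insert b S' \<inter> S = S - {a, a'}" using that assms(6) by (auto simp: S'_def)
    then show ?thesis using c2 cS by simp
  qed
  have "(\<Sum>b\<in>N - S - {c}. of_nat (card (insert b S' \<inter> S) choose card S') :: complex) = 0"
    using b by (intro sum.neutral) auto
  with nin show "paths_lrl N S' S = 2"
    unfolding paths_lrl_eq[OF hyps] split
    by (subst sum.insert, simp, simp, subst sum.insert) (simp_all only: a binomial_n_n, simp_all)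
qed

lemma matrix_vector_axis: "(A *v axis k 1) $ j = (A $ j $ k :: 'a :: semiring_1)"
  by (simp add: matrix_vector_mult_def axis_def if_distrib[of "(*) _"] sum.delta cong: if_cong)

lemma triple_product_entry:
  "(A ** B ** C) $ z $ y = (\<Sum>w\<in>UNIV. \<Sum>u\<in>UNIV. A $ z $ w * B $ w $ u * (C $ u $ y :: complex))"
  unfolding matrix_matrix_mult_def
  by (simp add: sum_distrib_right) (rule sum.swap)

section \<open>The flattened Johnson graph\<close>

text \<open>Descent builds a walk of length \<open>r y\<close>, and a rank rising by at most one per
  edge excludes shorter walks. The edge relation is arbitrary so that the Johnson graph and its
  flattening are both covered.\<close>

lemma graph_dist_eq_rank:
  fixes r :: "'v \<Rightarrow> nat"
  assumes step: "\<And>y z. (y, z) \<in> E \<Longrightarrow> r z \<le> Suc (r y)"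
    and descend: "\<And>y. y \<in> X \<Longrightarrow> r y \<noteq> 0 \<Longrightarrow> \<exists>z\<in>X. (z, y) \<in> E \<and> r y = Suc (r z)"
    and zero: "\<And>y. y \<in> X \<Longrightarrow> r y = 0 \<longleftrightarrow> y = x"
    and "x \<in> X" "y \<in> X"
  shows "graph_dist E x y = r y"
  unfolding graph_dist_def
proof (rule Least_equality)
  have "(x, y) \<in> E ^^ k" if "r y = k" "y \<in> X" for k y
    using that
  proof (induction k arbitrary: y)
    case 0
    then show ?case using zero by simp
  next
    case (Suc k)
    then obtain z where "z \<in> X" "(z, y) \<in> E" "r y = Suc (r z)" using descend by force
    with Suc show ?case by auto
  qed
  then show "(x, y) \<in> E ^^ r y" using assms by blast
next
  fix k assume "(x, y) \<in> E ^^ k"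
  then show "r y \<le> k"
  proof (induction k arbitrary: y)
    case 0
    then show ?case using zero \<open>x \<in> X\<close> by auto
  next
    case (Suc k)
    then obtain z where "(x, z) \<in> E ^^ k" "(z, y) \<in> E" by auto
    then show ?case using Suc.IH step by (meson Suc_le_mono le_trans)
  qed
qed

locale johnson =
  fixes x :: "'a::finite set" and D :: nat
  assumes x_vertex: "x \<in> johnson_vertices D"
begin

abbreviation X :: "'a set set" where "X \<equiv> johnson_vertices D"
abbreviation J :: "('a set \<times> 'a set) set" where "J \<equiv> johnson_edges D"
abbreviation F :: "('a set \<times> 'a set) set" where "F \<equiv> flat_edges J x"

lemma card_x: "card x = D" using x_vertex by (simp add: johnson_vertices_def)

lemma card_compl_x: "card (- x) = CARD('a) - D"
  by (simp add: Compl_eq_Diff_UNIV card_Diff_subset card_x)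

text \<open>Both \<open>x\<close> and \<open>y\<close> consist of \<open>x \<inter> y\<close> and
  one of the differences. Hence vertices correspond to pairs of equally large subsets of
  \<open>x\<close> and \<open>- x\<close>.\<close>

lemma card_vertex: "y \<in> X \<longleftrightarrow> card (x - y) = card (y - x)"
proof -
  have "card (x - y) + card (x \<inter> y) = D" "card (y - x) + card (x \<inter> y) = card y"
    using card_Int_Diff[of x y] card_Int_Diff[of y x] card_x by (simp_all add: Int_commute)
  then show ?thesis by (auto simp: johnson_vertices_def)
qed

lemma edge_step:
  assumes "(y, z) \<in> J"
  shows "card (x - z) \<le> Suc (card (x - y))"
proof -
  have "card (y - z) = 1"
    using assms card_Diff_subset_Int[of y z] by (auto simp: johnson_edges_def johnson_vertices_def)
  moreover have "card (x - z) \<le> card ((x - y) \<union> (y - z))" by (intro card_mono) auto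
  ultimately show ?thesis using card_Un_le[of "x - y" "y - z"] by simp
qed

text \<open>Trade a point of \<open>y - x\<close> for a point of \<open>x - y\<close>.\<close>

lemma edge_descend:
  assumes "y \<in> X" "card (x - y) \<noteq> 0"
  shows "\<exists>z\<in>X. (z, y) \<in> J \<and> card (x - y) = Suc (card (x - z))"
proof -
  from assms have "card (y - x) \<noteq> 0" using card_vertex by simp
  with assms obtain s t where st: "s \<in> x - y" "t \<in> y - x" by (metis card.empty ex_in_conv)
  define z where "z = insert s (y - {t})"
  have cy: "card y = Suc (card (y - {t}))" using st by (metis DiffE card_Suc_Diff1 finite)
  then have "card z = card y" using st by (simp add: z_def del: card_Diff_singleton)
  moreover have "z \<inter> y = y - {t}" using st by (auto simp: z_def)
  moreover have "x - z = (x - y) - {s}" using st by (auto simp: z_def)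
  ultimately show ?thesis
    using assms cy st card_Suc_Diff1[of "x - y" s]
    by (intro bexI[of _ z]) (auto simp: johnson_edges_def johnson_vertices_def)
qed

lemma rank_zero: "y \<in> X \<Longrightarrow> card (x - y) = 0 \<longleftrightarrow> y = x"
  using card_vertex[of y]
  by (metis Diff_cancel Diff_eq_empty_iff card.empty card_0_eq finite subset_antisym)

lemma graph_dist_johnson: "y \<in> X \<Longrightarrow> graph_dist J x y = card (x - y)"
  by (rule graph_dist_eq_rank[where X = X and r = "\<lambda>y. card (x - y)"])
    (use edge_step edge_descend rank_zero x_vertex in auto)

lemma flat_iff: "(y, z) \<in> F \<longleftrightarrow> (y, z) \<in> J \<and> card (x - y) \<noteq> card (x - z)"
proof -
  have "(y, z) \<in> J \<Longrightarrow> y \<in> X \<and> z \<in> X" by (auto simp: johnson_edges_def)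
  then show ?thesis using graph_dist_johnson by (auto simp: flat_edges_def)
qed

lemma flat_sym: "(y, z) \<in> F \<longleftrightarrow> (z, y) \<in> F"
  unfolding flat_iff by (auto simp: johnson_edges_def Int_commute)

text \<open>Flattening preserves distances from \<open>x\<close>, since the descending edges join
  different ranks and therefore survive.\<close>

lemma graph_dist_flat: "y \<in> X \<Longrightarrow> graph_dist F x y = card (x - y)"
proof (rule graph_dist_eq_rank[where X = X and r = "\<lambda>y. card (x - y)"])
  show "\<exists>z\<in>X. (z, y) \<in> F \<and> card (x - y) = Suc (card (x - z))"
    if "y \<in> X" "card (x - y) \<noteq> 0" for y
    using edge_descend[OF that] by (auto simp: flat_iff)
qed (use edge_step rank_zero x_vertex in \<open>auto simp: flat_iff\<close>)

lemma eccentricity_flat: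
  assumes "CARD('a) \<ge> 2 * D"
  shows "eccentricity X F x = D"
proof -
  \<comment> \<open>There is room for a vertex disjoint from \<open>x\<close>, and it attains the
    distance \<open>D\<close>.\<close>
  have "card (- x) \<ge> D" using assms card_compl_x by simp
  then obtain y where y: "y \<subseteq> - x" "card y = D" using obtain_subset_with_card_n by metis
  then have yX: "y \<in> X" by (simp add: johnson_vertices_def)
  have "x - y = x" using y by auto
  then have yd: "graph_dist F x y = D" using graph_dist_flat[OF yX] card_x by simp
  have "graph_dist F x z \<le> D" if "z \<in> X" for z
    using graph_dist_flat[OF that] card_mono[of x "x - z"] card_x by auto
  then show ?thesis
    unfolding eccentricity_def using yd yX by (intro Max_eqI) (auto intro: rev_image_eqI)
qed

section \<open>Edges between layers, and their factorisation over \<open>x\<close> and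
  \<open>- x\<close>\<close>

lemma dual_idem_sandwich:
  "(dual_idem X F x i ** adjacency F ** dual_idem X F x j) $ z $ y =
     of_bool (z \<in> X \<and> y \<in> X \<and> card (x - z) = i \<and> card (x - y) = j \<and> (z, y) \<in> F)"
proof -
  have d: "dual_idem X F x i = (\<chi> y z. of_bool (y = z) * of_bool (y \<in> X \<and> card (x - y) = i))" for i
    by (auto simp: dual_idem_def vec_eq_iff graph_dist_flat)
  have "(dual_idem X F x i ** adjacency F ** dual_idem X F x j) $ z $ y
    = (\<Sum>u\<in>UNIV. (\<Sum>w\<in>UNIV. of_bool (z = w) * (of_bool (z \<in> X \<and> card (x - z) = i) * of_bool ((w, u) \<in> F)))
        * (of_bool (u = y) * of_bool (u \<in> X \<and> card (x - u) = j)))"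
    by (simp add: d matrix_matrix_mult_def adjacency_def of_bool_def mult.assoc)
  also have "\<dots> = (\<Sum>u\<in>UNIV. of_bool (u = y) *
       ((of_bool (z \<in> X \<and> card (x - z) = i) * of_bool ((z, u) \<in> F)) * of_bool (u \<in> X \<and> card (x - u) = j)))"
    by (intro sum.cong refl) (simp add: of_bool_def if_distrib[of "\<lambda>a. a * _"] sum.delta' cong: if_cong)
  also have "\<dots> = of_bool (z \<in> X \<and> y \<in> X \<and> card (x - z) = i \<and> card (x - y) = j \<and> (z, y) \<in> F)"
    by (simp add: of_bool_def if_distrib[of "\<lambda>a. a * _"] sum.delta cong: if_cong)
  finally show ?thesis .
qed

text \<open>The tensor product of the two covering matrices. It is defined for all sets, not just
  vertices, so that sums over intermediate sets factor.\<close>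

definition pair_covers :: "'a set \<Rightarrow> 'a set \<Rightarrow> complex" where
  "pair_covers z y = covers (x - z) (x - y) * covers (z - x) (y - x)"

text \<open>Both differences change by one point, so equality of their sizes is preserved. This
  allows the membership conditions on intermediate vertices to be dropped.\<close>

lemma pair_covers_vertex: "pair_covers z y \<noteq> 0 \<Longrightarrow> z \<in> X \<longleftrightarrow> y \<in> X"
  by (auto simp: pair_covers_def covers_def card_vertex)

lemma flat_lower_iff:
  assumes "z \<in> X" "y \<in> X"
  shows "(z, y) \<in> F \<and> card (x - y) = Suc (card (x - z)) \<longleftrightarrow>
    x - z \<subseteq> x - y \<and> card (x - y) = Suc (card (x - z)) \<and>
    z - x \<subseteq> y - x \<and> card (y - x) = Suc (card (z - x))" (is "?l \<longleftrightarrow> ?r")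
proof
  have cards: "card z = D" "card y = D" using assms by (auto simp: johnson_vertices_def)
  have cx: "card (x \<inter> w) + card (x - w) = D" for w
    using card_Int_Diff[of x w] card_x by simp
  show ?r if ?l
  proof -
    from that have e: "card (z \<inter> y) + 1 = D" and c: "card (x - y) = Suc (card (x - z))"
      by (simp_all add: flat_iff, simp add: johnson_edges_def)
    have one: "card (z - y) = 1" using card_Diff_subset_Int[of z y] e cards by auto
    \<comment> \<open>The intersection with \<open>x\<close> gains a point although
      \<open>z - y\<close> has only one. Both bounds below are thus tight: the new point lies in
      \<open>x\<close>, and no point of \<open>x \<inter> y\<close> is lost.\<close>
    have "card (x \<inter> z) = Suc (card (x \<inter> y))" using cx[of z] cx[of y] c by linarith
    moreover have "card (x \<inter> z) = card (x \<inter> z \<inter> y) + card (x \<inter> z - y)"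
      by (simp add: card_Int_Diff)
    moreover have "card (x \<inter> z \<inter> y) \<le> card (x \<inter> y)" by (intro card_mono) auto
    moreover have "card (x \<inter> z - y) \<le> card (z - y)" by (intro card_mono) auto
    ultimately have "card (x \<inter> z \<inter> y) = card (x \<inter> y)" "card (x \<inter> z - y) = card (z - y)"
      using one by linarith+
    then have "x \<inter> z \<inter> y = x \<inter> y" "x \<inter> z - y = z - y"
      by - (rule card_subset_eq; auto)+
    then have "x - z \<subseteq> x - y" "z - x \<subseteq> y - x" by blast+
    then show ?thesis using c assms card_vertex by simp
  qed
  show ?l if r: ?r
  proof -
    from r have "z \<inter> y = (x \<inter> y) \<union> (z - x)" by auto
    moreover have "card ((x \<inter> y) \<union> (z - x)) = card (x \<inter> y) + card (z - x)"
      by (intro card_Un_disjoint) auto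
    ultimately have "card (z \<inter> y) + 1 = D"
      using cx[of y] r assms card_vertex by auto
    then show ?thesis using r assms unfolding flat_iff by (auto simp: johnson_edges_def)
  qed
qed

text \<open>The map from \<open>w\<close> to \<open>(x - w, w - x)\<close> is a bijection from all
  sets onto \<open>Pow x \<times> Pow (- x)\<close>; no condition on sizes links the two
  factors.\<close>

lemma sum_sets_product:
  "(\<Sum>w\<in>UNIV. g (x - w) * h (w - x)) = (\<Sum>S\<in>Pow x. g S) * (\<Sum>T\<in>Pow (- x). h T :: complex)"
proof -
  have "(\<Sum>S\<in>Pow x. g S) * (\<Sum>T\<in>Pow (- x). h T) = (\<Sum>(S, T)\<in>Pow x \<times> Pow (- x). g S * h T)"
    by (simp add: sum_product sum.cartesian_product)
  also have "\<dots> = (\<Sum>w\<in>UNIV. g (x - w) * h (w - x))"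
    by (rule sum.reindex_bij_witness[of _ "\<lambda>w. (x - w, w - x)" "\<lambda>(S, T). (x - S) \<union> T"])
      (auto intro!: arg_cong2[where f = "\<lambda>a b. g a * h b"])
  finally show ?thesis by simp
qed

lemma sum_sets_product2:
  "(\<Sum>w\<in>UNIV. \<Sum>u\<in>UNIV. g (x - w) (x - u) * h (w - x) (u - x)) =
   (\<Sum>S\<in>Pow x. \<Sum>S'\<in>Pow x. g S S') * (\<Sum>T\<in>Pow (- x). \<Sum>T'\<in>Pow (- x). h T T' :: complex)"
  by (simp add: sum_sets_product sum_sets_product[of "\<lambda>S. \<Sum>S'\<in>Pow x. g S S'"
        "\<lambda>T. \<Sum>T'\<in>Pow (- x). h T T'"])

section \<open>Matrix entries and linear constraints when the ground set has at least
  \<open>2 * D\<close> points\<close>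

context
  assumes large: "CARD('a) \<ge> 2 * D"
begin

lemma lowering_entry:
  "lowering X F x $ z $ y = of_bool (z \<in> X \<and> y \<in> X) * pair_covers z y"
proof -
  have le: "card (x - y) \<le> D" using card_mono[of x "x - y"] card_x by auto
  have "lowering X F x $ z $ y = (\<Sum>i = 1..D.
      of_bool (z \<in> X \<and> y \<in> X \<and> card (x - z) = i - 1 \<and> card (x - y) = i \<and> (z, y) \<in> F))"
    by (simp add: lowering_def eccentricity_flat[OF large] dual_idem_sandwich)
  \<comment> \<open>At most one layer contributes. Rank zero lies outside the range, in accordance
    with the impossible equation \<open>0 = Suc _\<close> that follows.\<close>
  also have "\<dots> = (\<Sum>i = 1..D. if i = card (x - y) then
      of_bool (z \<in> X \<and> y \<in> X \<and> card (x - z) = i - 1 \<and> (z, y) \<in> F) else 0)"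
    by (rule sum.cong) auto
  also have "\<dots> = of_bool (z \<in> X \<and> y \<in> X \<and> (z, y) \<in> F \<and> card (x - y) = Suc (card (x - z)))"
    using le by (auto simp: sum.delta)
  also have "\<dots> = of_bool (z \<in> X \<and> y \<in> X) * pair_covers z y"
    using flat_lower_iff[of z y] by (auto simp: pair_covers_def covers_def)
  finally show ?thesis .
qed

lemma raising_entry: "raising X F x $ y $ z = lowering X F x $ z $ y"
proof -
  have "raising X F x $ y $ z = (\<Sum>i<D.
      of_bool (y \<in> X \<and> z \<in> X \<and> card (x - y) = Suc i \<and> card (x - z) = i \<and> (y, z) \<in> F))"
    by (simp add: raising_def eccentricity_flat[OF large] dual_idem_sandwich)
  also have "\<dots> = (\<Sum>i = 1..D.
      of_bool (z \<in> X \<and> y \<in> X \<and> card (x - z) = i - 1 \<and> card (x - y) = i \<and> (z, y) \<in> F))"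
    by (rule sum.reindex_bij_witness[of _ "\<lambda>i. i - 1" Suc]) (auto simp: flat_sym)
  also have "\<dots> = lowering X F x $ z $ y"
    by (simp add: lowering_def eccentricity_flat[OF large] dual_idem_sandwich)
  finally show ?thesis .
qed

text \<open>A nonzero \<open>pair_covers\<close> keeps intermediate sets within \<open>X\<close>, so
  they may range over all sets, and the double sum splits into two path counts.\<close>

lemma path_entries:
  assumes "z \<in> X" "y \<in> X"
  defines "L \<equiv> lowering X F x" and "R \<equiv> raising X F x"
  shows "(R ** L ** L) $ z $ y = paths_rll x (x - z) (x - y) * paths_rll (- x) (z - x) (y - x)"
    and "(L ** R ** L) $ z $ y = paths_lrl x (x - z) (x - y) * paths_lrl (- x) (z - x) (y - x)"
    and "(L ** L ** R) $ z $ y = paths_llr x (x - z) (x - y) * paths_llr (- x) (z - x) (y - x)"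
proof -
  note entries = L_def R_def triple_product_entry raising_entry lowering_entry
  have "(R ** L ** L) $ z $ y
      = (\<Sum>w\<in>UNIV. \<Sum>u\<in>UNIV. pair_covers w z * pair_covers w u * pair_covers u y)"
    unfolding entries using assms(1,2) pair_covers_vertex
    by (intro sum.cong refl) (auto simp: of_bool_def)
  also have "\<dots> = paths_rll x (x - z) (x - y) * paths_rll (- x) (z - x) (y - x)"
    unfolding paths_rll_def sum_sets_product2[symmetric] by (simp add: pair_covers_def mult_ac)
  finally show "(R ** L ** L) $ z $ y
    = paths_rll x (x - z) (x - y) * paths_rll (- x) (z - x) (y - x)" .
  have "(L ** R ** L) $ z $ y
      = (\<Sum>w\<in>UNIV. \<Sum>u\<in>UNIV. pair_covers z w * pair_covers u w * pair_covers u y)"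
    unfolding entries using assms(1,2) pair_covers_vertex
    by (intro sum.cong refl) (auto simp: of_bool_def)
  also have "\<dots> = paths_lrl x (x - z) (x - y) * paths_lrl (- x) (z - x) (y - x)"
    unfolding paths_lrl_def sum_sets_product2[symmetric] by (simp add: pair_covers_def mult_ac)
  finally show "(L ** R ** L) $ z $ y
    = paths_lrl x (x - z) (x - y) * paths_lrl (- x) (z - x) (y - x)" .
  have "(L ** L ** R) $ z $ y
      = (\<Sum>w\<in>UNIV. \<Sum>u\<in>UNIV. pair_covers z w * pair_covers w u * pair_covers y u)"
    unfolding entries using assms(1,2) pair_covers_vertex
    by (intro sum.cong refl) (auto simp: of_bool_def)
  also have "\<dots> = paths_llr x (x - z) (x - y) * paths_llr (- x) (z - x) (y - x)"
    unfolding paths_llr_def sum_sets_product2[symmetric] by (simp add: pair_covers_def mult_ac)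
  finally show "(L ** L ** R) $ z $ y
    = paths_llr x (x - z) (x - y) * paths_llr (- x) (z - x) (y - x)" .
qed

text \<open>Apply the identity to the basis vector of the vertex encoded by \<open>(S, T)\<close>
  and read off the coordinate of the vertex encoded by \<open>(S', T')\<close>.\<close>

lemma uniform_entry:
  fixes em ep fi :: complex
  defines "L \<equiv> lowering X F x" and "R \<equiv> raising X F x"
  assumes uni: "\<forall>v \<in> range ((*v) (dual_idem X F x i)).
      em *s ((R ** L ** L) *v v) + (L ** R ** L) *v v + ep *s ((L ** L ** R) *v v) = fi *s (L *v v)"
    and S: "S \<subseteq> x" "card S = i" "S' \<subseteq> x"
    and T: "T \<subseteq> - x" "card T = i" "T' \<subseteq> - x"
    and c: "card S' = card T'"
  shows "em * (paths_rll x S' S * paths_rll (- x) T' T) + paths_lrl x S' S * paths_lrl (- x) T' T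
    + ep * (paths_llr x S' S * paths_llr (- x) T' T) = fi * (covers S' S * covers T' T)"
proof -
  define y where "y = (x - S) \<union> T"
  define z where "z = (x - S') \<union> T'"
  have y: "x - y = S" "y - x = T" using S T by (auto simp: y_def)
  have z: "x - z = S'" "z - x = T'" using S T by (auto simp: z_def)
  have yz: "z \<in> X" "y \<in> X" using S T y z c by (auto simp: card_vertex)
  have "dual_idem X F x i *v axis y 1 = axis y 1"
    using y S yz
    unfolding vec_eq_iff matrix_vector_axis
    by (auto simp: dual_idem_def axis_def graph_dist_flat)
  then have "axis y 1 \<in> range ((*v) (dual_idem X F x i))" by (metis rangeI)
  with uni have "em *s ((R ** L ** L) *v axis y 1) + (L ** R ** L) *v axis y 1
      + ep *s ((L ** L ** R) *v axis y 1) = fi *s (L *v axis y 1)" by blast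
  then have "(em *s ((R ** L ** L) *v axis y 1) + (L ** R ** L) *v axis y 1
      + ep *s ((L ** L ** R) *v axis y 1)) $ z = (fi *s (L *v axis y 1)) $ z" by simp
  then have "em * (R ** L ** L) $ z $ y + (L ** R ** L) $ z $ y + ep * (L ** L ** R) $ z $ y
      = fi * L $ z $ y"
    by (simp add: matrix_vector_axis)
  then show ?thesis
    using yz by (simp add: L_def R_def path_entries lowering_entry pair_covers_def y z)
qed

text \<open>An exchange in either factor makes the lowering entry zero, which removes
  \<open>fi\<close>, and it contributes the same factor 2 to all three terms. Here
  \<open>2 \<le> i\<close> supplies two points to delete, and \<open>i < D\<close> supplies a point
  to add on each side.\<close>

lemma uniform_coefficients:
  fixes em ep fi :: complex
  defines "L \<equiv> lowering X F x" and "R \<equiv> raising X F x"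
  assumes uni: "\<forall>v \<in> range ((*v) (dual_idem X F x i)).
      em *s ((R ** L ** L) *v v) + (L ** R ** L) *v v + ep *s ((L ** L ** R) *v v) = fi *s (L *v v)"
    and i: "2 \<le> i" "i < D"
  shows "em + 1 + ep = 0"
    and "\<And>N. N = D \<or> N = CARD('a) - D \<Longrightarrow>
      2 * (of_nat i - 1) * em + of_nat N + 2 * (of_nat N - of_nat i) * ep = 0"
proof -
  have ex: "\<exists>S a a' c. S \<subseteq> N \<and> card S = i \<and> a \<in> S \<and> a' \<in> S \<and> a \<noteq> a' \<and> c \<in> N - S"
    if "i < card N" for N :: "'a set"
  proof -
    obtain S where S: "S \<subseteq> N" "card S = i" using \<open>i < card N\<close>
      by (meson less_imp_le obtain_subset_with_card_n)
    then obtain c where "c \<in> N - S" using \<open>i < card N\<close>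
      by (metis DiffI card_mono finite not_le subsetI)
    moreover obtain a where a: "a \<in> S" using S i by fastforce
    moreover have "card (S - {a}) \<noteq> 0" using S i a by simp
    then obtain a' where "a' \<in> S - {a}" by (metis card.empty ex_in_conv)
    ultimately show ?thesis using S by blast
  qed
  have "i < card x" "i < card (- x)" using i large card_compl_x card_x by auto
  from ex[OF this(1)] ex[OF this(2)] obtain S a a' c T b b' d
    where S: "S \<subseteq> x" "card S = i" "a \<in> S" "a' \<in> S" "a \<noteq> a'" "c \<in> x - S"
      and T: "T \<subseteq> - x" "card T = i" "b \<in> T" "b' \<in> T" "b \<noteq> b'" "d \<in> - x - T" by blast
  define S1 where "S1 = insert c (S - {a, a'})"
  define T1 where "T1 = insert d (T - {b, b'})"
  note pS = paths_exchange[OF finite S(1,3-6), folded S1_def]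
  note pT = paths_exchange[OF finite T(1,3-6), folded T1_def]
  note qS = paths_remove[OF finite S(1,3)]
  note qT = paths_remove[OF finite T(1,3)]
  have cards: "card (S - {a}) = i - 1" "card (T - {b}) = i - 1" "card S1 = i - 1" "card T1 = i - 1"
    using S T pS(1) pT(1) by auto
  have subs: "S - {a} \<subseteq> x" "T - {b} \<subseteq> - x" "S1 \<subseteq> x" "T1 \<subseteq> - x"
    using S T by (auto simp: S1_def T1_def)
  have eqs: "card S1 = card T1" "card (S - {a}) = card T1" "card S1 = card (T - {b})"
    using cards by simp_all
  have cov: "covers S1 S = 0" "covers T1 T = 0"
    using S(6) T(6) by (auto simp: covers_def S1_def T1_def)
  note entry = uniform_entry[OF uni[unfolded L_def R_def] S(1,2) _ T(1,2)]
  show "em + 1 + ep = 0"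
  proof -
    from entry[OF subs(3,4) eqs(1)] have "4 * (em + 1 + ep) = 0"
      by (simp only: pS pT cov) Groebner_Basis.algebra
    then show ?thesis by (metis mult_eq_0_iff zero_neq_numeral)
  qed
  fix N assume N: "N = D \<or> N = CARD('a) - D"
  \<comment> \<open>Deleting within \<open>x\<close> and exchanging within \<open>- x\<close> gives
    the relation for \<open>N = D\<close>; the opposite choice gives the other value of
    \<open>N\<close>.\<close>
  from entry[OF subs(1,4) eqs(2)]
  have 1: "2 * (of_nat i - 1) * em + of_nat D + 2 * (of_nat D - of_nat i) * ep = 0"
    by (simp only: qS pT cov card_x S(2)) Groebner_Basis.algebra
  from entry[OF subs(3,2) eqs(3)]
  have 2: "2 * (of_nat i - 1) * em + of_nat (CARD('a) - D) + 2 * (of_nat (CARD('a) - D) - of_nat i) * ep = 0"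
    by (simp only: qT pS cov card_compl_x T(2)) Groebner_Basis.algebra
  show "2 * (of_nat i - 1) * em + of_nat N + 2 * (of_nat N - of_nat i) * ep = 0"
    using N 1 2 by blast
qed

end

end

section \<open>Incompatibility of the constraints\<close>

theorem theorem9p4:
  fixes x :: "'a::finite set" and n D :: nat
  assumes "D \<ge> 3" and "n \<ge> 2 * D" and "CARD('a) = n"
    and "x \<in> johnson_vertices D"
  shows "\<not> supports_uniform_structure (johnson_vertices D) (johnson_edges D) x"
proof
  assume "supports_uniform_structure (johnson_vertices D) (johnson_edges D) x"
  interpret johnson x D by unfold_locales (rule assms)
  have large: "CARD('a) \<ge> 2 * D" using assms by simp
  note ecc = eccentricity_flat[OF large]
  from \<open>supports_uniform_structure _ _ _\<close> obtain U f where par: "parameter_matrix D U"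
    and uni: "\<And>i. i \<in> {1..D} \<Longrightarrow> \<forall>v \<in> range ((*v) (dual_idem X F x i)).
        e_minus U i *s ((raising X F x ** lowering X F x ** lowering X F x) *v v)
        + (lowering X F x ** raising X F x ** lowering X F x) *v v
        + e_plus D U i *s ((lowering X F x ** lowering X F x ** raising X F x) *v v)
        = f i *s (lowering X F x *v v)"
    unfolding supports_uniform_structure_def admits_uniform_structure_def Let_def ecc by blast
  have sum: "e_minus U i = - 1 - e_plus D U i" if "2 \<le> i" "i < D" for i
  proof -
    have "e_minus U i + 1 + e_plus D U i = 0"
      using that by (intro uniform_coefficients(1)[OF large uni that]) auto
    then show ?thesis by Groebner_Basis.algebra
  qed
  \<comment> \<open>The result of eliminating \<open>e_minus U i\<close> between the two
    relations.\<close>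
  have lin: "e_plus D U i * (2 * (of_nat N - 2 * of_nat i + 1)) = - (of_nat N - 2 * of_nat i + 2)"
    if "2 \<le> i" "i < D" "N = D \<or> N = n - D" for i N
  proof -
    have "2 * (of_nat i - 1) * e_minus U i + of_nat N + 2 * (of_nat N - of_nat i) * e_plus D U i = 0"
      using uniform_coefficients(2)[OF large uni that(1,2), of N] that assms(3) by simp
    then show ?thesis unfolding sum[OF that(1,2)] by Groebner_Basis.algebra
  qed
  have eq: "n - D = D"
  proof (rule ccontr)
    assume ne: "n - D \<noteq> D"
    \<comment> \<open>The difference of the relations for the two values of \<open>N\<close> at
      \<open>i = 2\<close>. It forces \<open>e_plus D U 2\<close> to be -1/2, and the relation for
      \<open>N = D\<close> then reads \<open>D - 3 = D - 2\<close>.\<close>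
    have "(of_nat (n - D) - of_nat D) * (2 * e_plus D U 2 + 1) = 0"
      using lin[of 2 D] lin[of 2 "n - D"] assms(1)
      by (simp add: algebra_simps)
    then have "2 * e_plus D U 2 + 1 = 0" using ne by auto
    moreover have "e_plus D U 2 * (2 * (of_nat D - 3)) = - (of_nat D - 2)"
      using lin[of 2 D] assms(1) by simp
    ultimately have "(1::complex) = 0" by Groebner_Basis.algebra
    then show False by simp
  qed
  show False
  proof (cases "even D")
    case False
    then obtain k where k: "D = 2 * k + 1" by (elim oddE)
    \<comment> \<open>At \<open>i = k + 1\<close> the coefficient of \<open>e_plus\<close> vanishes
      while the right-hand side is -1.\<close>
    then show False using lin[of "k + 1" D] assms(1) by simp
  next
    case True
    then obtain k where k: "D = 2 * k" by (elim evenE)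
    have k2: "k \<ge> 2" using k assms(1) by simp
    \<comment> \<open>At \<open>i = k\<close> the relation is
      \<open>2 * e_plus D U k = - 2\<close>.\<close>
    have "e_plus D U k = - 1" using lin[of k D] k k2 by simp
    then have "e_minus U k = 0" using sum[of k] k k2 by simp
    then have "U k (k - 1) = 0" using k2 by (simp add: e_minus_def)
    \<comment> \<open>Here the right-hand side of \<open>lin\<close> is zero and the coefficient is
      -2. As \<open>k + 1 < D\<close>, this is a genuine entry of \<open>U\<close> and not the zero
      convention at the last row.\<close>
    moreover have "e_plus D U (k + 1) = 0" using lin[of "k + 1" D] k k2 by simp
    then have "U (k + 1) (k + 2) = 0" using k k2 by (simp add: e_plus_def)
    \<comment> \<open>The witnesses are \<open>k\<close> below the diagonal and \<open>k + 2\<close>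
      above it, so neither off-diagonal is free of zeros.\<close>
    ultimately have "\<not> (\<forall>i\<in>{2..D}. U i (i - 1) \<noteq> 0)" "\<not> (\<forall>i\<in>{2..D}. U (i - 1) i \<noteq> 0)"
      using k k2 by (auto intro: bexI[of _ k] bexI[of _ "k + 2"])
    then show False using par unfolding parameter_matrix_def by blast
  qed
qed

end
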